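(* Let $m=q\geq 2$ be even integers, and let $k,\ell \geq 0$ be integers such that $k+\ell = \frac{m-2}{2}$. Then $(M^2R^2)^\ell M^2R(MR^2MRM^2R)^{k}MR^2 (M^2R^2)^\ell$ generates a self-conjugate CMP of $m^{2m}$. For a given even value of $m=q$, there are $\frac{m}{2}$ distinct self-conjugate CMPs of $m^{2m}$ in this family (i.e. as $(k,\ell)$ ranges over all pairs of non-negative integers with $k+\ell=\frac{m-2}{2}$).
   Context: Let $m\ge 2$ be an integer. A partition $\lambda$ of a positive integer is $m$-ary if all its parts are powers $m^i$, $i\ge 0$ (so $m^0=1$ is allowed). If $a_i$ is the number of times the part $m^i$ appears in $\lambda$, one writes $\lambda=(a_k,a_{k-1},\ldots,a_0)_m$, where $a_k\neq 0$ and $a_i=0$ for $i>k$. A CMP (conjugate $m$-ary partition, i.e. conjugate $(m,m)$-ary partition) is an $m$-ary partition $\lambda$ whose conjugate $\lambda'$ is also $m$-ary; it is self-conjugate if $\lambda=\lambda'$. On CMPs $\lambda=(a_k,\ldots,a_0)_m$ define the operators (each producing a CMP; here $q=m$): raise $R(\lambda)=(ma_k,\ldots,ma_0)_m$ and migration $M(\lambda)=(1,a_k-1,a_{k-1},\ldots,a_0)_m$. Sequences of operators are composed as functions (rightmost applied first); a sequence $A$ generates the partition $A(1)_m$, where $(1)_m$ is the trivial partition of $1$. *)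

theory Defs
  imports Main "HOL-Library.Multiset"
begin

text \<open>A partition is the multiset of its (positive) parts.\<close>

definition partition_of :: "nat \<Rightarrow> nat multiset \<Rightarrow> bool" where
  "partition_of n \<mu> \<longleftrightarrow> 0 \<notin># \<mu> \<and> sum_mset \<mu> = n"

text \<open>The \<open>j\<close>-th part of the conjugate (the length of the \<open>j\<close>-th column of the Young diagram)
  is the number of parts of size at least \<open>j\<close>; \<open>j\<close> runs from 1 to the largest part.\<close>

definition conjugate :: "nat multiset \<Rightarrow> nat multiset" where
  "conjugate \<mu> = {# size {# x \<in># \<mu>. j \<le> x #}. j \<in># mset_set {j. 1 \<le> j \<and> (\<exists>x\<in>#\<mu>. j \<le> x)} #}"

definition ary :: "nat \<Rightarrow> nat multiset \<Rightarrow> bool" where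
  "ary m \<mu> \<longleftrightarrow> \<mu> \<noteq> {#} \<and> (\<forall>x\<in>#\<mu>. \<exists>i. x = m ^ i)"

definition CMP :: "nat \<Rightarrow> nat multiset \<Rightarrow> bool" where
  "CMP m \<mu> \<longleftrightarrow> ary m \<mu> \<and> ary m (conjugate \<mu>)"

definition self_conjugate :: "nat multiset \<Rightarrow> bool" where
  "self_conjugate \<mu> \<longleftrightarrow> conjugate \<mu> = \<mu>"

text \<open>The partition \<open>(a\<^sub>k, \<dots>, a\<^sub>0)\<^sub>m\<close>, as a function of the list \<open>[a\<^sub>k, \<dots>, a\<^sub>0]\<close>
  (highest power first).\<close>

primrec of_coeffs :: "nat \<Rightarrow> nat list \<Rightarrow> nat multiset" where
  "of_coeffs m [] = {#}"
| "of_coeffs m (a # as) = replicate_mset a (m ^ length as) + of_coeffs m as"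

text \<open>Conversely, the list \<open>[a\<^sub>k, \<dots>, a\<^sub>0]\<close> with \<open>a\<^sub>k \<noteq> 0\<close> of an \<open>m\<close>-ary partition.\<close>

definition coeffs :: "nat \<Rightarrow> nat multiset \<Rightarrow> nat list" where
  "coeffs m \<mu> = map (\<lambda>i. count \<mu> (m ^ i)) (rev [0..<Suc (Max {i. m ^ i \<in># \<mu>})])"

fun migrate_coeffs :: "nat list \<Rightarrow> nat list" where
  "migrate_coeffs (a # as) = 1 # (a - 1) # as"
| "migrate_coeffs [] = []"

definition R :: "nat \<Rightarrow> nat multiset \<Rightarrow> nat multiset" where
  "R m \<mu> = of_coeffs m (map (\<lambda>a. m * a) (coeffs m \<mu>))"

definition M :: "nat \<Rightarrow> nat multiset \<Rightarrow> nat multiset" where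
  "M m \<mu> = of_coeffs m (migrate_coeffs (coeffs m \<mu>))"

definition generates :: "nat \<Rightarrow> (nat multiset \<Rightarrow> nat multiset) \<Rightarrow> nat multiset" where
  "generates m A = A (of_coeffs m [1])"

text \<open>\<open>(M\<^sup>2R\<^sup>2)\<^sup>l M\<^sup>2R (MR\<^sup>2MRM\<^sup>2R)\<^sup>k MR\<^sup>2 (M\<^sup>2R\<^sup>2)\<^sup>l\<close>, rightmost factor applied first.\<close>

definition op_sequence :: "nat \<Rightarrow> nat \<Rightarrow> nat \<Rightarrow> nat multiset \<Rightarrow> nat multiset" where
  "op_sequence m k l =
     (M m ^^ 2 \<circ> R m ^^ 2) ^^ l
     \<circ> M m ^^ 2 \<circ> R m
     \<circ> (M m \<circ> R m ^^ 2 \<circ> M m \<circ> R m \<circ> M m ^^ 2 \<circ> R m) ^^ k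
     \<circ> M m \<circ> R m ^^ 2
     \<circ> (M m ^^ 2 \<circ> R m ^^ 2) ^^ l"

lemma count_of_coeffs:
  assumes "2 \<le> m"
  shows "count (of_coeffs m as) (m ^ i) = (if i < length as then rev as ! i else 0)"
  using assms by (induction as) (auto simp: nth_append less_Suc_eq)

lemma coeffs_of_coeffs:
  assumes m: "2 \<le> m" and a: "a \<noteq> 0"
  shows "coeffs m (of_coeffs m (a # as)) = a # as"
proof -
  let ?S = "{i. m ^ i \<in># of_coeffs m (a # as)}"
  have iff: "m ^ i \<in># of_coeffs m (a # as) \<longleftrightarrow> i < Suc (length as) \<and> rev (a # as) ! i \<noteq> 0" for i
    unfolding count_greater_zero_iff[symmetric] count_of_coeffs[OF m] by simp
  have "Max ?S = length as"
  proof (rule Max_eqI)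
    show "finite ?S" by (rule finite_subset[of _ "{..length as}"]) (auto simp only: iff mem_Collect_eq atMost_iff less_Suc_eq_le)
    show "length as \<in> ?S" using a by (simp only: iff mem_Collect_eq) (simp add: nth_append)
    show "y \<le> length as" if "y \<in> ?S" for y using that by (simp only: iff mem_Collect_eq less_Suc_eq_le)
  qed
  then have "coeffs m (of_coeffs m (a # as))
      = rev (map (\<lambda>i. count (of_coeffs m (a # as)) (m ^ i)) [0..<length (rev (a # as))])"
    unfolding coeffs_def by (simp only: rev_map length_rev length_Cons)
  also have "map (\<lambda>i. count (of_coeffs m (a # as)) (m ^ i)) [0..<length (rev (a # as))]
      = map ((!) (rev (a # as))) [0..<length (rev (a # as))]"
    by (rule map_cong[OF refl]) (simp only: count_of_coeffs[OF m] set_upt atLeastLessThan_iff length_rev if_True)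
  also have "\<dots> = rev (a # as)" by (rule map_nth)
  finally show ?thesis by simp
qed

lemma R_of_coeffs:
  assumes "2 \<le> m" "a \<noteq> 0"
  shows "R m (of_coeffs m (a # as)) = of_coeffs m (map (\<lambda>a. m * a) (a # as))"
  unfolding R_def coeffs_of_coeffs[OF assms] ..

lemma M_of_coeffs:
  assumes "2 \<le> m" "a \<noteq> 0"
  shows "M m (of_coeffs m (a # as)) = of_coeffs m (1 # (a - 1) # as)"
  unfolding M_def coeffs_of_coeffs[OF assms] by simp

end

theory Submission
  imports Defs Complex_Main
begin

text \<open>
  Encode a sequence of operators as a word in the letters \<open>Raise\<close> and \<open>Migrate\<close>, first applied
  letter first, and let it act on the partition \<open>(1)\<close>. Raising multiplies every multiplicity
  by \<open>m\<close>, so it stretches the Young diagram by \<open>m\<close> vertically; migrating lengthens one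
  longest row from \<open>m\<^sup>c\<close> to \<open>m\<^sup>c\<^sup>+\<^sup>1\<close>, where \<open>c\<close> counts the migrations so far. Under conjugation
  these become a horizontal stretch by \<open>m\<close> and the addition of \<open>m\<^sup>c\<^sup>+\<^sup>1 - m\<^sup>c\<close> rows of length 1.
  But a horizontal stretch is what an additional \<open>Migrate\<close> at the \<^emph>\<open>beginning\<close> of a word causes,
  and the additional rows of length 1 are what an additional \<open>Raise\<close> at the beginning causes.
  Hence conjugation reverses the word and exchanges the two letters
  (\<open>conjugate_word_partition\<close>). The words of the family are invariant under this operation, as
  each of their blocks \<open>RRMM\<close>, \<open>RMMRMRRM\<close> is, while \<open>RRM\<close> and \<open>RMM\<close> are exchanged; so
  the generated partitions are self-conjugate.

  For the size, divide it by \<open>m\<^sup>c\<close>. The normalised size \<open>t\<close> obeys \<open>t \<mapsto> m t\<close> under raising and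
  \<open>t - 1 \<mapsto> (t - 1) / m\<close> under migration, so every block acts on \<open>t\<close> by an affine map. The blocks
  \<open>RRMM\<close> and \<open>RMMRMRRM\<close> are translations, by \<open>1 - m\<^sup>-\<^sup>2\<close> and by \<open>2m (1 - m\<^sup>-\<^sup>2)\<close>. The latter
  is applied between \<open>RRM\<close> and \<open>RMM\<close>, whose linear parts are \<open>m\<close> and \<open>1/m\<close>, and hence counts as
  \<open>2 (1 - m\<^sup>-\<^sup>2)\<close>, as much as two copies of \<open>RRMM\<close>. Thus the total depends only on \<open>k + l\<close>; for
  \<open>2 (k + l) + 2 = m\<close> it is \<open>t = m\<close>, with \<open>c = 2m - 1\<close> migrations.

  Finally, a word can be read off from its partition (\<open>inj_word_partition\<close>): the multiplicity of
  the largest part is 1 after a migration and a multiple of \<open>m\<close> after a raise, so the partition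
  shows the last letter, and both operators can be undone. Distinct words of the family therefore
  give distinct partitions.
\<close>

section \<open>Words of operators\<close>

datatype letter = Raise | Migrate

primrec letter_op :: "nat \<Rightarrow> letter \<Rightarrow> nat multiset \<Rightarrow> nat multiset" where
  "letter_op m Raise = R m"
| "letter_op m Migrate = M m"

definition word_partition :: "nat \<Rightarrow> letter list \<Rightarrow> nat multiset" where
  "word_partition m w = fold (letter_op m) w (of_coeffs m [1])"

abbreviation migrations :: "letter list \<Rightarrow> nat" where
  "migrations w \<equiv> count_list w Migrate"

abbreviation raises :: "letter list \<Rightarrow> nat" where
  "raises w \<equiv> count_list w Raise"

lemma word_partition_Nil: "word_partition m [] = {#1#}"
  by (simp add: word_partition_def)

lemma word_partition_snoc: "word_partition m (w @ [x]) = letter_op m x (word_partition m w)"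
  by (simp add: word_partition_def)

text \<open>Both operators are defined on the coefficient list whose first entry is nonzero. The point
  here is that they preserve this normal form, so that they act directly on lists, and that the
  exponent of the largest part counts the migrations.\<close>

lemma word_partition_coeffs:
  assumes "2 \<le> m"
  obtains a as where "word_partition m w = of_coeffs m (a # as)" "a \<noteq> 0" "length as = migrations w"
proof -
  have "\<exists>a as. word_partition m w = of_coeffs m (a # as) \<and> a \<noteq> 0 \<and> length as = migrations w"
  proof (induction w rule: rev_induct)
    case Nil
    show ?case
      by (rule exI[of _ 1], rule exI[of _ "[]"]) (simp add: word_partition_Nil)
  next
    case (snoc x w)
    then obtain a as where w: "word_partition m w = of_coeffs m (a # as)" "a \<noteq> 0"
      "length as = migrations w" by blast
    show ?case
    proof (cases x)
      case Raise
      have "word_partition m (w @ [x]) = of_coeffs m ((m * a) # map (\<lambda>a. m * a) as)"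
        by (simp only: word_partition_snoc Raise letter_op.simps w(1) R_of_coeffs[OF assms w(2)]
            list.map)
      moreover have "m * a \<noteq> 0" using assms w(2) by simp
      moreover have "length (map (\<lambda>a. m * a) as) = migrations (w @ [x])"
        using w(3) Raise by simp
      ultimately show ?thesis by blast
    next
      case Migrate
      have "word_partition m (w @ [x]) = of_coeffs m (1 # (a - 1) # as)"
        by (simp only: word_partition_snoc Migrate letter_op.simps w(1) M_of_coeffs[OF assms w(2)])
      moreover have "length ((a - 1) # as) = migrations (w @ [x])"
        using w(3) Migrate by simp
      ultimately show ?thesis by (metis one_neq_zero)
    qed
  qed
  then show thesis using that by blast
qed

section \<open>The effect of a further letter at the end or at the beginning of a word\<close>

lemma of_coeffs_map_mult: "of_coeffs m (map (\<lambda>a. n * a) as) = repeat_mset n (of_coeffs m as)"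
  by (induction as) (auto simp: multiset_eq_iff distrib_left)

lemma of_coeffs_bounds:
  assumes "x \<in># of_coeffs m as"
  shows "\<exists>i < length as. x = m ^ i"
  using assms
proof (induction as)
  case (Cons a as)
  then show ?case by (auto split: if_splits intro: less_SucI)
qed simp

lemma word_partition_parts:
  assumes "2 \<le> m" "x \<in># word_partition m w"
  obtains i where "i \<le> migrations w" "x = m ^ i"
  using word_partition_coeffs[OF assms(1), of w] of_coeffs_bounds assms(2)
  by (metis length_Cons less_Suc_eq_le)

lemma word_partition_le:
  assumes "2 \<le> m" "x \<in># word_partition m w"
  shows "x \<le> m ^ migrations w"
  using word_partition_parts[OF assms] assms(1) by (metis one_le_numeral order_trans power_increasing)

lemma top_part_in_word_partition:
  assumes "2 \<le> m"
  shows "m ^ migrations w \<in># word_partition m w"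
  using word_partition_coeffs[OF assms, of w] by fastforce

lemma word_partition_snoc_Raise:
  assumes "2 \<le> m"
  shows "word_partition m (w @ [Raise]) = repeat_mset m (word_partition m w)"
  using word_partition_coeffs[OF assms, of w]
  by (metis R_of_coeffs[OF assms] letter_op.simps(1) of_coeffs_map_mult word_partition_snoc)

lemma word_partition_snoc_Migrate:
  assumes "2 \<le> m"
  shows "word_partition m (w @ [Migrate])
    = add_mset (m ^ Suc (migrations w)) (word_partition m w - {#m ^ migrations w#})"
proof -
  obtain a as where w: "word_partition m w = of_coeffs m (a # as)" "a \<noteq> 0"
    "length as = migrations w" using word_partition_coeffs[OF assms] .
  then obtain b where "a = Suc b" by (meson not0_implies_Suc)
  have "word_partition m (w @ [Migrate]) = of_coeffs m (1 # (a - 1) # as)"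
    by (simp only: word_partition_snoc letter_op.simps w(1) M_of_coeffs[OF assms w(2)])
  then show ?thesis using w(1) w(3) \<open>a = Suc b\<close> by simp
qed

text \<open>Starting from the single part \<open>m\<close> instead of 1 shifts all later powers of \<open>m\<close> by one.\<close>

lemma word_partition_Cons_Migrate:
  assumes "2 \<le> m"
  shows "word_partition m (Migrate # w) = image_mset (\<lambda>x. m * x) (word_partition m w)"
proof (induction w rule: rev_induct)
  case Nil
  show ?case using word_partition_snoc_Migrate[OF assms, of "[]"] by (simp add: word_partition_Nil)
next
  case (snoc x w)
  show ?case
  proof (cases x)
    case Raise
    have "image_mset f (repeat_mset n A) = repeat_mset n (image_mset f A)"
      for f :: "nat \<Rightarrow> nat" and n A
      by (induction n) auto
    then show ?thesis
      using word_partition_snoc_Raise[OF assms, of w]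
        word_partition_snoc_Raise[OF assms, of "Migrate # w"] snoc Raise by simp
  next
    case Migrate
    then show ?thesis
      using word_partition_snoc_Migrate[OF assms, of w] top_part_in_word_partition[OF assms, of w]
        word_partition_snoc_Migrate[OF assms, of "Migrate # w"] snoc
      by (simp add: image_mset_Diff)
  qed
qed

text \<open>Starting from \<open>m\<close> parts 1 instead of one adds \<open>m - 1\<close> parts 1. Migrations can leave
  them aside, because the parts coming from the single original part always include a largest
  one; each later raise multiplies the number of additional parts by \<open>m\<close>.\<close>

lemma word_partition_Cons_Raise:
  assumes "2 \<le> m"
  shows "word_partition m (Raise # w)
    = word_partition m w + replicate_mset ((m - 1) * m ^ raises w) 1"
proof (induction w rule: rev_induct)
  case Nil
  show ?case using word_partition_snoc_Raise[OF assms, of "[]"] assms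
    by (auto simp add: word_partition_Nil multiset_eq_iff)
next
  case (snoc x w)
  show ?case
  proof (cases x)
    case Raise
    then show ?thesis
      using word_partition_snoc_Raise[OF assms, of w]
        word_partition_snoc_Raise[OF assms, of "Raise # w"] snoc
      by (auto simp: multiset_eq_iff algebra_simps)
  next
    case Migrate
    then show ?thesis
      using word_partition_snoc_Migrate[OF assms, of w] top_part_in_word_partition[OF assms, of w]
        word_partition_snoc_Migrate[OF assms, of "Raise # w"] snoc
      by simp
  qed
qed

section \<open>Conjugation reverses a word and exchanges its letters\<close>

text \<open>Repeating every row \<open>n\<close> times makes every column \<open>n\<close> times as long.\<close>

lemma conjugate_repeat:
  assumes "0 < n"
  shows "conjugate (repeat_mset n \<mu>) = image_mset (\<lambda>x. n * x) (conjugate \<mu>)"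
proof -
  have f: "filter_mset P (repeat_mset n \<mu>) = repeat_mset n (filter_mset P \<mu>)" for P
    by (auto simp: multiset_eq_iff)
  have "x \<in># repeat_mset n \<mu> \<longleftrightarrow> x \<in># \<mu>" for x
    using assms by (simp flip: count_greater_zero_iff)
  then have "set_mset (repeat_mset n \<mu>) = set_mset \<mu>" by blast
  then show ?thesis
    unfolding conjugate_def by (simp add: f image_mset.compositionality comp_def)
qed

text \<open>Lengthening the longest row by \<open>q - p\<close> cells appends \<open>q - p\<close> columns of height 1.\<close>

lemma conjugate_extend_largest:
  assumes le: "\<forall>x\<in>#\<nu>. x \<le> p" and pq: "p \<le> q"
  shows "conjugate (add_mset q \<nu>) = conjugate (add_mset p \<nu>) + replicate_mset (q - p) 1"
proof -
  have S: "{j. 1 \<le> j \<and> (\<exists>x\<in>#add_mset r \<nu>. j \<le> x)} = {1..r}" if "p \<le> r" for r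
    using le that by (auto; meson order_trans)
  have "{1..q} = {1..p} \<union> {p<..q}" using pq by auto
  then have "mset_set {1..q} = mset_set {1..p} + mset_set {p<..q}"
    by (metis finite_atLeastAtMost finite_greaterThanAtMost greaterThanAtMost_iff atLeastAtMost_iff
        disjoint_iff leD mset_set_Union)
  then have "conjugate (add_mset q \<nu>)
    = {# size {# x \<in># add_mset q \<nu>. j \<le> x #}. j \<in># mset_set {1..p} #}
      + {# size {# x \<in># add_mset q \<nu>. j \<le> x #}. j \<in># mset_set {p<..q} #}"
    unfolding conjugate_def S[OF pq] by simp
  also have "{# size {# x \<in># add_mset q \<nu>. j \<le> x #}. j \<in># mset_set {1..p} #}
      = conjugate (add_mset p \<nu>)"
    unfolding conjugate_def S[OF order_refl] using pq by (intro image_mset_cong) auto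
  also have "{# size {# x \<in># add_mset q \<nu>. j \<le> x #}. j \<in># mset_set {p<..q} #}
      = {# 1. j \<in># mset_set {p<..q} #}"
  proof (rule image_mset_cong)
    fix j assume j: "j \<in># mset_set {p<..q}"
    then have "{# x \<in># \<nu>. j \<le> x #} = {#}"
      using le by (auto simp: filter_mset_eq_conv)
    with j show "size {# x \<in># add_mset q \<nu>. j \<le> x #} = 1" by simp
  qed
  finally show ?thesis by (simp add: image_mset_const_eq)
qed

primrec swap_letter :: "letter \<Rightarrow> letter" where
  "swap_letter Raise = Migrate"
| "swap_letter Migrate = Raise"

definition dual_word :: "letter list \<Rightarrow> letter list" where
  "dual_word w = rev (map swap_letter w)"

lemma dual_word_snoc: "dual_word (w @ [x]) = swap_letter x # dual_word w"
  by (simp add: dual_word_def)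

lemma dual_word_append: "dual_word (v @ w) = dual_word w @ dual_word v"
  by (simp add: dual_word_def)

lemma raises_dual_word: "raises (dual_word w) = migrations w"
proof (induction w)
  case (Cons x w)
  then show ?case by (cases x) (auto simp: dual_word_def)
qed (simp add: dual_word_def)

text \<open>Induction at the end of the word: a raise or migration performed last becomes, under
  conjugation, the effect of the other letter put first. In the case of a migration the number of
  new rows matches because the dual word has as many raises as \<open>w\<close> has migrations.\<close>

theorem conjugate_word_partition:
  assumes "2 \<le> m"
  shows "conjugate (word_partition m w) = word_partition m (dual_word w)"
proof (induction w rule: rev_induct)
  case Nil
  have "{j. Suc 0 \<le> j \<and> j \<le> Suc 0} = {1}" by auto
  then show ?case by (simp add: word_partition_Nil dual_word_def conjugate_def)
next
  case (snoc x w)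
  show ?case
  proof (cases x)
    case Raise
    then show ?thesis
      using assms snoc by (simp add: word_partition_snoc_Raise dual_word_snoc conjugate_repeat
          word_partition_Cons_Migrate)
  next
    case Migrate
    let ?p = "m ^ migrations w" and ?\<nu> = "word_partition m w - {#m ^ migrations w#}"
    have w: "word_partition m w = add_mset ?p ?\<nu>"
      using top_part_in_word_partition[OF assms] by simp
    have "conjugate (word_partition m (w @ [x])) = conjugate (add_mset (m * ?p) ?\<nu>)"
      using Migrate by (simp add: word_partition_snoc_Migrate[OF assms])
    also have "\<dots> = conjugate (add_mset ?p ?\<nu>) + replicate_mset (m * ?p - ?p) 1"
      using assms word_partition_le[OF assms]
      by (intro conjugate_extend_largest) (auto dest: in_diffD)
    also have "\<dots> = word_partition m (dual_word w) + replicate_mset ((m - 1) * ?p) 1"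
      using snoc w by (simp add: diff_mult_distrib)
    also have "\<dots> = word_partition m (dual_word (w @ [x]))"
      using Migrate by (simp add: dual_word_snoc word_partition_Cons_Raise[OF assms] raises_dual_word)
    finally show ?thesis .
  qed
qed

lemma CMP_word_partition:
  assumes "2 \<le> m"
  shows "CMP m (word_partition m w)"
proof -
  have "ary m (word_partition m v)" for v
    unfolding ary_def using top_part_in_word_partition[OF assms, of v] word_partition_parts[OF assms]
    by (metis empty_not_add_mset multi_member_split)
  then show ?thesis
    unfolding CMP_def conjugate_word_partition[OF assms] by blast
qed

section \<open>A word is determined by its partition\<close>

lemma coeffs_word_partition_snoc:
  assumes "2 \<le> m"
  obtains a as where "word_partition m w = of_coeffs m (a # as)" "a \<noteq> 0"
    "coeffs m (word_partition m (w @ [x])) =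
      (case x of Raise \<Rightarrow> m * a # map (\<lambda>a. m * a) as | Migrate \<Rightarrow> 1 # (a - 1) # as)"
proof -
  obtain a as where w: "word_partition m w = of_coeffs m (a # as)" "a \<noteq> 0"
    using word_partition_coeffs[OF assms, of w] by metis
  have "coeffs m (word_partition m (w @ [x])) =
      (case x of Raise \<Rightarrow> m * a # map (\<lambda>a. m * a) as | Migrate \<Rightarrow> 1 # (a - 1) # as)"
  proof (cases x)
    case Raise
    have "m * a \<noteq> 0" using assms w(2) by simp
    then show ?thesis
      by (simp only: word_partition_snoc Raise letter_op.simps letter.case w(1)
          R_of_coeffs[OF assms w(2)] list.map coeffs_of_coeffs[OF assms \<open>m * a \<noteq> 0\<close>])
  next
    case Migrate
    show ?thesis
      by (simp only: word_partition_snoc Migrate letter_op.simps letter.case w(1)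
          M_of_coeffs[OF assms w(2)] coeffs_of_coeffs[OF assms one_neq_zero])
  qed
  with w show thesis using that by blast
qed

text \<open>Induction at the end of the word. The mixed cases fail because 1 is not a multiple of
  \<open>m\<close>, and the partition \<open>(1)\<close> of the empty word differs from a migrated one in having
  a single coefficient.\<close>

lemma inj_word_partition:
  assumes "2 \<le> m"
  shows "inj (word_partition m)"
proof (rule injI)
  fix v w :: "letter list"
  have Nil: "coeffs m (word_partition m []) = [1]"
    using coeffs_of_coeffs[OF assms, of 1 "[]"] by (simp add: word_partition_Nil)
  have Nil_snoc: "word_partition m [] \<noteq> word_partition m (u @ [x])" for u x
  proof
    assume eq: "word_partition m [] = word_partition m (u @ [x])"
    obtain a as where "coeffs m (word_partition m (u @ [x])) =
      (case x of Raise \<Rightarrow> m * a # map (\<lambda>a. m * a) as | Migrate \<Rightarrow> 1 # (a - 1) # as)"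
      using coeffs_word_partition_snoc[OF assms] by metis
    with Nil eq show False using assms by (auto split: letter.splits)
  qed
  show "word_partition m v = word_partition m w \<Longrightarrow> v = w"
  proof (induction v arbitrary: w rule: rev_induct)
    case Nil
    then show ?case using Nil_snoc by (metis rev_exhaust)
  next
    case (snoc x v)
    obtain u y where w: "w = u @ [y]"
      using Nil_snoc snoc.prems by (metis rev_exhaust)
    obtain a as where a: "word_partition m v = of_coeffs m (a # as)" "a \<noteq> 0"
      "coeffs m (word_partition m (v @ [x])) =
        (case x of Raise \<Rightarrow> m * a # map (\<lambda>a. m * a) as | Migrate \<Rightarrow> 1 # (a - 1) # as)"
      using coeffs_word_partition_snoc[OF assms] .
    obtain b bs where b: "word_partition m u = of_coeffs m (b # bs)" "b \<noteq> 0"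
      "coeffs m (word_partition m (u @ [y])) =
        (case y of Raise \<Rightarrow> m * b # map (\<lambda>a. m * a) bs | Migrate \<Rightarrow> 1 # (b - 1) # bs)"
      using coeffs_word_partition_snoc[OF assms] .
    have eq: "(case x of Raise \<Rightarrow> m * a # map (\<lambda>a. m * a) as | Migrate \<Rightarrow> 1 # (a - 1) # as)
      = (case y of Raise \<Rightarrow> m * b # map (\<lambda>a. m * a) bs | Migrate \<Rightarrow> 1 # (b - 1) # bs)"
      using a(3) b(3) snoc.prems w by simp
    have inj: "inj (\<lambda>a. m * a)" using assms by (auto intro: injI)
    have "x = y \<and> a = b \<and> as = bs"
      using eq assms a(2) b(2) inj_map_eq_map[OF inj]
      by (cases x; cases y) auto
    then show ?case using snoc.IH[of u] a(1) b(1) w by simp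
  qed
qed

section \<open>The size of the generated partition\<close>

text \<open>The effect of a letter on the size of a partition divided by its largest part. A migration
  turns \<open>(s, p)\<close> into \<open>(s + (c - 1) p, c p)\<close>, where \<open>s\<close> is the size and \<open>p\<close> the
  largest part; the fixed point 1 of this step makes it a contraction of \<open>t - 1\<close>.\<close>

primrec size_step :: "real \<Rightarrow> letter \<Rightarrow> real \<Rightarrow> real" where
  "size_step c Raise t = c * t"
| "size_step c Migrate t = 1 + (t - 1) / c"

lemma sum_word_partition:
  assumes "2 \<le> m"
  shows "real (sum_mset (word_partition m w)) = real m ^ migrations w * fold (size_step m) w 1"
proof (induction w rule: rev_induct)
  case Nil
  show ?case by (simp add: word_partition_Nil)
next
  case (snoc x w)
  show ?case
  proof (cases x)
    case Raise
    have "sum_mset (repeat_mset n A) = n * sum_mset A" for n and A :: "nat multiset"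
      by (induction n) auto
    then show ?thesis using snoc Raise by (simp add: word_partition_snoc_Raise[OF assms])
  next
    case Migrate
    let ?p = "m ^ migrations w"
    obtain \<nu> where \<nu>: "word_partition m w = add_mset ?p \<nu>"
      using top_part_in_word_partition[OF assms] by (meson multi_member_split)
    have "real (sum_mset (word_partition m (w @ [x])))
        = real (sum_mset (word_partition m w)) - real ?p + real m * real ?p"
      using Migrate by (simp add: word_partition_snoc_Migrate[OF assms] \<nu>)
    also have "\<dots> = real m ^ migrations (w @ [x]) * fold (size_step m) (w @ [x]) 1"
      using snoc Migrate assms by (simp add: field_simps)
    finally show ?thesis .
  qed
qed

section \<open>The self-dual family\<close>

definition power_word :: "letter list \<Rightarrow> nat \<Rightarrow> letter list" where
  "power_word w n = concat (replicate n w)"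

lemma power_word_0 [simp]: "power_word w 0 = []"
  by (simp add: power_word_def)

lemma power_word_Suc [simp]: "power_word w (Suc n) = w @ power_word w n"
  by (simp add: power_word_def)

lemma power_word_commute: "power_word w n @ w = w @ power_word w n"
  by (induction n) auto

lemma dual_power_word: "dual_word (power_word w n) = power_word (dual_word w) n"
  by (induction n) (simp_all add: dual_word_append power_word_commute, simp add: dual_word_def)

lemma fold_power_word: "fold f (power_word w n) = fold f w ^^ n"
  by (induction n) (simp_all add: funpow_swap1 fun_eq_iff)

lemma migrations_power_word: "migrations (power_word w n) = n * migrations w"
  by (induction n) auto

abbreviation outer_block :: "letter list" where
  "outer_block \<equiv> [Raise, Raise, Migrate, Migrate]"

abbreviation inner_block :: "letter list" where
  "inner_block \<equiv> [Raise, Migrate, Migrate, Raise, Migrate, Raise, Raise, Migrate]"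

definition family_word :: "nat \<Rightarrow> nat \<Rightarrow> letter list" where
  "family_word k l = power_word outer_block l @ [Raise, Raise, Migrate]
     @ power_word inner_block k @ [Raise, Migrate, Migrate] @ power_word outer_block l"

lemma generates_op_sequence: "generates m (op_sequence m k l) = word_partition m (family_word k l)"
proof -
  have 1: "fold (letter_op m) outer_block = M m ^^ 2 \<circ> R m ^^ 2"
    by (simp add: fun_eq_iff numeral_2_eq_2)
  have 2: "fold (letter_op m) inner_block
      = M m \<circ> R m ^^ 2 \<circ> M m \<circ> R m \<circ> M m ^^ 2 \<circ> R m"
    by (simp add: fun_eq_iff numeral_2_eq_2)
  show ?thesis
    unfolding generates_def op_sequence_def word_partition_def family_word_def
      fold_append fold_power_word 1 2
    by (simp add: numeral_2_eq_2)
qed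

lemma dual_family_word: "dual_word (family_word k l) = family_word k l"
proof -
  have "dual_word outer_block = outer_block" "dual_word inner_block = inner_block"
    "dual_word [Raise, Raise, Migrate] = [Raise, Migrate, Migrate]"
    "dual_word [Raise, Migrate, Migrate] = [Raise, Raise, Migrate]"
    by (simp_all add: dual_word_def)
  then show ?thesis
    unfolding family_word_def dual_word_append dual_power_word by simp
qed

text \<open>After \<open>l\<close> outer blocks, the fourth letter to follow is \<open>Raise\<close>, whereas it is \<open>Migrate\<close>
  if a further outer block follows.\<close>

lemma family_word_neq:
  assumes "l < l'"
  shows "family_word k l \<noteq> family_word k' l'"
proof -
  have add: "power_word w (a + b) = power_word w a @ power_word w b" for w a b
    by (induction a) auto
  obtain d where l': "l' = l + Suc d" using assms less_iff_Suc_add by auto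
  show ?thesis
    unfolding family_word_def l' add by (cases k) auto
qed

lemma sum_family_word:
  assumes m: "2 \<le> m" and kl: "2 * (k + l) + 2 = m"
  shows "sum_mset (word_partition m (family_word k l)) = m ^ (2 * m)"
proof -
  define c where "c = real m"
  have c: "c \<noteq> 0" "c = 2 * (real k + real l) + 2"
    using m by (simp_all add: c_def flip: kl)
  have translation: "((\<lambda>t. t + d) ^^ n) t = t + real n * d" for d t :: real and n
    by (induction n) (simp_all add: algebra_simps)
  have outer: "fold (size_step c) outer_block = (\<lambda>t. t + (1 - 1 / c\<^sup>2))"
    using c(1) by (simp add: fun_eq_iff field_simps power2_eq_square)
  have inner: "fold (size_step c) inner_block = (\<lambda>t. t + 2 * c * (1 - 1 / c\<^sup>2))"
    using c(1) by (simp add: fun_eq_iff field_simps power2_eq_square)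
  have "fold (size_step c) (family_word k l) 1
      = 1 + (2 * (real k + real l) + 1) * (1 - 1 / c\<^sup>2) + 1 / c - 1 / c\<^sup>2"
    unfolding family_word_def fold_append fold_power_word comp_def outer inner translation
    using c(1) by (simp add: field_simps power2_eq_square)
  also have "\<dots> = 1 + (c - 1) * (1 - 1 / c\<^sup>2) + 1 / c - 1 / c\<^sup>2"
    by (simp add: c(2))
  also have "\<dots> = c"
    using c(1) by (simp add: field_simps power2_eq_square)
  finally have t: "fold (size_step c) (family_word k l) 1 = c" .
  have "migrations (family_word k l) = 2 * (2 * (k + l) + 2) - 1"
    by (simp add: family_word_def migrations_power_word)
  \<comment> \<open>the factor \<open>t = m\<close> supplies the power missing from \<open>m\<^sup>2\<^sup>m\<^sup>-\<^sup>1\<close>\<close>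
  then have "Suc (migrations (family_word k l)) = 2 * m"
    using kl by simp
  then have "real (sum_mset (word_partition m (family_word k l))) = real (m ^ (2 * m))"
    using sum_word_partition[OF m, of "family_word k l"] t unfolding c_def
    by (metis power_Suc2 of_nat_power)
  then show ?thesis by (simp only: of_nat_eq_iff)
qed

theorem corollary5p10:
  fixes m :: nat
  assumes "m \<ge> 2" and "even m"
  shows "(\<forall>k l. k + l = (m - 2) div 2 \<longrightarrow>
            partition_of (m ^ (2 * m)) (generates m (op_sequence m k l))
            \<and> CMP m (generates m (op_sequence m k l))
            \<and> self_conjugate (generates m (op_sequence m k l)))
         \<and> card {generates m (op_sequence m k l) | k l. k + l = (m - 2) div 2} = m div 2"
proof (intro conjI allI impI)
  fix k l assume "k + l = (m - 2) div 2"
  then have kl: "2 * (k + l) + 2 = m" using assms by auto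
  have "0 \<notin># word_partition m (family_word k l)"
    using word_partition_parts[OF assms(1)] assms(1)
    by (metis not_numeral_le_zero power_eq_0_iff)
  then show "partition_of (m ^ (2 * m)) (generates m (op_sequence m k l))"
    unfolding partition_of_def generates_op_sequence using sum_family_word[OF assms(1) kl] by simp
  show "CMP m (generates m (op_sequence m k l))"
    unfolding generates_op_sequence by (rule CMP_word_partition[OF assms(1)])
  show "self_conjugate (generates m (op_sequence m k l))"
    unfolding self_conjugate_def generates_op_sequence conjugate_word_partition[OF assms(1)]
      dual_family_word ..
next
  define n where "n = (m - 2) div 2"
  let ?f = "\<lambda>l. word_partition m (family_word (n - l) l)"
  have "inj_on ?f {..n}"
    using inj_word_partition[OF assms(1)] family_word_neq
    by (intro inj_onI) (metis injD nat_neq_iff)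
  moreover have "{generates m (op_sequence m k l) | k l. k + l = n} = ?f ` {..n}"
    unfolding generates_op_sequence
  proof (intro equalityI subsetI; clarsimp)
    show "word_partition m (family_word k l) \<in> 
      (\<lambda>l'. word_partition m (family_word (k + l - l') l')) ` {..k + l}"
      for k l by (rule image_eqI[of _ _ l]) auto
    show "\<exists>k l'. word_partition m (family_word (n - l) l) = word_partition m (family_word k l')
      \<and> k + l' = n"
      if "l \<le> n" for l using that by (intro exI[of _ "n - l"] exI[of _ l]) simp
  qed
  moreover have "Suc n = m div 2" using assms by (auto simp: n_def)
  ultimately show "card {generates m (op_sequence m k l) | k l. k + l = (m - 2) div 2} = m div 2"
    unfolding n_def[symmetric] by (simp add: card_image)
qed

end
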